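(* The augmented estimate sequence gaps $$\bar\Gamma_k=\bar\psi_k^*-A_kf(y_k)+\frac{A_k}{2L_f}\|\nabla f(y_k)\|_*^2,\qquad k\ge1,$$ satisfy $$\bar\Gamma_k=\mathcal{D}_0-\mathcal{D}_k,\qquad k\ge1,$$ where the gap terms are $$\mathcal{D}_k=A_k\left(f(y_k)-\frac{1}{2L_f}\|\nabla f(y_k)\|_*^2-f(x^* )\right)+\frac12\|v_k-x^*\|^2,\qquad k\ge0.$$
   Context: $\mathbb{E}$ is an $n$-dimensional real vector space, $\mathbb{E}^*$ its dual, $\langle s,x\rangle$ the value of $s\in\mathbb{E}^*$ at $x\in\mathbb{E}$. $B:\mathbb{E}\to\mathbb{E}^*$ is a symmetric positive definite linear operator, $\|x\|=\sqrt{\langle Bx,x\rangle}$ on $\mathbb{E}$ and $\|g\|_*=\sqrt{\langle g,B^{-1}g\rangle}$ on $\mathbb{E}^*$. $f:\mathbb{E}\to\mathbb{R}$ is convex and differentiable, with gradient Lipschitz continuous with constant $L_f>0$. The set $X^*$ of minimizers of $f$ is non-empty and $x^*\in X^*$ is fixed. The algorithm has starting point $x_0\in\mathbb{E}$, auxiliary points $y_k\in\mathbb{E}$ ($y_0=x_0$) and weights $a_{k+1}>0$, with $A_0=0$ and $A_{k+1}=A_k+a_{k+1}$. The primal-dual estimate functions are $\psi_0(y,g)=\frac12\|y-x_0\|^2$ and $\psi_{k+1}(y,g)=\psi_k(y,g)+a_{k+1}w_{k+1}(y,g)$ with $$w_{k+1}(y,g)=f(y_{k+1})+\langle\nabla f(y_{k+1}),y-y_{k+1}\rangle+\frac{1}{2L_f}\|g-\nabla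 f(y_{k+1})\|_*^2,$$ so that $\psi_k(y,g)=A_kW_k(y,g)+\frac12\|y-x_0\|^2$ with $W_k=\frac{1}{A_k}\sum_{i=1}^ka_iw_i$ for $k\ge1$. $(v_k,s_k)$ denotes the minimizer of $\psi_k$ over $\mathbb{E}\times\mathbb{E}^*$ ($v_0=x_0$, $s_0=0$), and $\psi_k^*$ its minimum value. The augmented estimate functions are $\bar\psi_k(y,g)=\psi_k(y,g)+A_k\left(f(x^* )-W_k(x^*,s_k)\right)$, $k\ge1$, and $\bar\psi_k^*=\min_{y\in\mathbb{E},g\in\mathbb{E}^*}\bar\psi_k(y,g)$. *)

theory Defs
  imports "HOL-Analysis.Analysis"
begin

text \<open>
  The space E is a type of class \<open>euclidean_space\<close>, its dual is the type of (bounded) linear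
  functionals \<open>'a \<Rightarrow>\<^sub>L real\<close>, and the pairing of s with x is \<open>blinfun_apply s x\<close>. The native inner
  product and norm of the type serve only to express differentiability, which does not depend on
  the choice of norm in finite dimension; all norms below come from B.
\<close>

definition sym_pos_def :: "('a::euclidean_space \<Rightarrow> 'a \<Rightarrow>\<^sub>L real) \<Rightarrow> bool" where
  "sym_pos_def B \<longleftrightarrow>
     linear B \<and>
     (\<forall>x y. blinfun_apply (B x) y = blinfun_apply (B y) x) \<and>
     (\<forall>x. x \<noteq> 0 \<longrightarrow> blinfun_apply (B x) x > 0)"

definition pnorm :: "('a::euclidean_space \<Rightarrow> 'a \<Rightarrow>\<^sub>L real) \<Rightarrow> 'a \<Rightarrow> real" where
  "pnorm B x = sqrt (blinfun_apply (B x) x)"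

definition dnorm :: "('a::euclidean_space \<Rightarrow> 'a \<Rightarrow>\<^sub>L real) \<Rightarrow> ('a \<Rightarrow>\<^sub>L real) \<Rightarrow> real" where
  "dnorm B g = sqrt (blinfun_apply g (inv B g))"

text \<open>Only the weights \<open>a 1, a 2, \<dots>\<close> are used; \<open>a 0\<close> is irrelevant.\<close>

primrec Acc :: "(nat \<Rightarrow> real) \<Rightarrow> nat \<Rightarrow> real" where
  "Acc a 0 = 0"
| "Acc a (Suc k) = Acc a k + a (Suc k)"

text \<open>In the following, \<open>f'\<close> is the gradient of \<open>f\<close> (with values in the dual space), \<open>L\<close> its
  Lipschitz constant, \<open>x0\<close> the starting point and \<open>ys\<close> the sequence of auxiliary points.\<close>

definition w ::
  "('a::euclidean_space \<Rightarrow> 'a \<Rightarrow>\<^sub>L real) \<Rightarrow> ('a \<Rightarrow> real) \<Rightarrow> ('a \<Rightarrow> 'a \<Rightarrow>\<^sub>L real) \<Rightarrow> real \<Rightarrow>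
   (nat \<Rightarrow> 'a) \<Rightarrow> nat \<Rightarrow> 'a \<Rightarrow> ('a \<Rightarrow>\<^sub>L real) \<Rightarrow> real" where
  "w B f f' L ys i y g =
     f (ys i) + blinfun_apply (f' (ys i)) (y - ys i) + 1 / (2 * L) * (dnorm B (g - f' (ys i)))\<^sup>2"

definition W ::
  "('a::euclidean_space \<Rightarrow> 'a \<Rightarrow>\<^sub>L real) \<Rightarrow> ('a \<Rightarrow> real) \<Rightarrow> ('a \<Rightarrow> 'a \<Rightarrow>\<^sub>L real) \<Rightarrow> real \<Rightarrow>
   (nat \<Rightarrow> 'a) \<Rightarrow> (nat \<Rightarrow> real) \<Rightarrow> nat \<Rightarrow> 'a \<Rightarrow> ('a \<Rightarrow>\<^sub>L real) \<Rightarrow> real" where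
  "W B f f' L ys a k y g = 1 / Acc a k * (\<Sum>i=1..k. a i * w B f f' L ys i y g)"

primrec psi ::
  "('a::euclidean_space \<Rightarrow> 'a \<Rightarrow>\<^sub>L real) \<Rightarrow> ('a \<Rightarrow> real) \<Rightarrow> ('a \<Rightarrow> 'a \<Rightarrow>\<^sub>L real) \<Rightarrow> real \<Rightarrow>
   'a \<Rightarrow> (nat \<Rightarrow> 'a) \<Rightarrow> (nat \<Rightarrow> real) \<Rightarrow> nat \<Rightarrow> 'a \<Rightarrow> ('a \<Rightarrow>\<^sub>L real) \<Rightarrow> real" where
  "psi B f f' L x0 ys a 0 = (\<lambda>y g. 1 / 2 * (pnorm B (y - x0))\<^sup>2)"
| "psi B f f' L x0 ys a (Suc k) =
     (\<lambda>y g. psi B f f' L x0 ys a k y g + a (Suc k) * w B f f' L ys (Suc k) y g)"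

text \<open>The pair \<open>(v\<^sub>k, s\<^sub>k)\<close>. The function \<open>psi \<dots> 0\<close> does not depend on its second argument, so its
  minimizer is not unique and is fixed by convention to be \<open>(x0, 0)\<close>.\<close>

definition psi_minimizer ::
  "('a::euclidean_space \<Rightarrow> 'a \<Rightarrow>\<^sub>L real) \<Rightarrow> ('a \<Rightarrow> real) \<Rightarrow> ('a \<Rightarrow> 'a \<Rightarrow>\<^sub>L real) \<Rightarrow> real \<Rightarrow>
   'a \<Rightarrow> (nat \<Rightarrow> 'a) \<Rightarrow> (nat \<Rightarrow> real) \<Rightarrow> nat \<Rightarrow> 'a \<times> ('a \<Rightarrow>\<^sub>L real)" where
  "psi_minimizer B f f' L x0 ys a k =
     (if k = 0 then (x0, 0)
      else arg_min (\<lambda>(y, g). psi B f f' L x0 ys a k y g) (\<lambda>_. True))"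

definition v where
  "v B f f' L x0 ys a k = fst (psi_minimizer B f f' L x0 ys a k)"

definition s where
  "s B f f' L x0 ys a k = snd (psi_minimizer B f f' L x0 ys a k)"

definition psi_bar ::
  "('a::euclidean_space \<Rightarrow> 'a \<Rightarrow>\<^sub>L real) \<Rightarrow> ('a \<Rightarrow> real) \<Rightarrow> ('a \<Rightarrow> 'a \<Rightarrow>\<^sub>L real) \<Rightarrow> real \<Rightarrow>
   'a \<Rightarrow> (nat \<Rightarrow> 'a) \<Rightarrow> (nat \<Rightarrow> real) \<Rightarrow> 'a \<Rightarrow> nat \<Rightarrow> 'a \<Rightarrow> ('a \<Rightarrow>\<^sub>L real) \<Rightarrow> real" where
  "psi_bar B f f' L x0 ys a xstar k y g =
     psi B f f' L x0 ys a k y g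
     + Acc a k * (f xstar - W B f f' L ys a k xstar (s B f f' L x0 ys a k))"

text \<open>The minimum value is the least element of the range (not merely its infimum).\<close>

definition psi_bar_min ::
  "('a::euclidean_space \<Rightarrow> 'a \<Rightarrow>\<^sub>L real) \<Rightarrow> ('a \<Rightarrow> real) \<Rightarrow> ('a \<Rightarrow> 'a \<Rightarrow>\<^sub>L real) \<Rightarrow> real \<Rightarrow>
   'a \<Rightarrow> (nat \<Rightarrow> 'a) \<Rightarrow> (nat \<Rightarrow> real) \<Rightarrow> 'a \<Rightarrow> nat \<Rightarrow> real" where
  "psi_bar_min B f f' L x0 ys a xstar k =
     (LEAST m. \<exists>y g. m = psi_bar B f f' L x0 ys a xstar k y g)"

definition Gamma_bar ::
  "('a::euclidean_space \<Rightarrow> 'a \<Rightarrow>\<^sub>L real) \<Rightarrow> ('a \<Rightarrow> real) \<Rightarrow> ('a \<Rightarrow> 'a \<Rightarrow>\<^sub>L real) \<Rightarrow> real \<Rightarrow>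
   'a \<Rightarrow> (nat \<Rightarrow> 'a) \<Rightarrow> (nat \<Rightarrow> real) \<Rightarrow> 'a \<Rightarrow> nat \<Rightarrow> real" where
  "Gamma_bar B f f' L x0 ys a xstar k =
     psi_bar_min B f f' L x0 ys a xstar k - Acc a k * f (ys k)
     + Acc a k / (2 * L) * (dnorm B (f' (ys k)))\<^sup>2"

definition gap ::
  "('a::euclidean_space \<Rightarrow> 'a \<Rightarrow>\<^sub>L real) \<Rightarrow> ('a \<Rightarrow> real) \<Rightarrow> ('a \<Rightarrow> 'a \<Rightarrow>\<^sub>L real) \<Rightarrow> real \<Rightarrow>
   'a \<Rightarrow> (nat \<Rightarrow> 'a) \<Rightarrow> (nat \<Rightarrow> real) \<Rightarrow> 'a \<Rightarrow> nat \<Rightarrow> real" where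
  "gap B f f' L x0 ys a xstar k =
     Acc a k * (f (ys k) - 1 / (2 * L) * (dnorm B (f' (ys k)))\<^sup>2 - f xstar)
     + 1 / 2 * (pnorm B (v B f f' L x0 ys a k - xstar))\<^sup>2"

end

(* psi k is a sum of squared distances, of y to x0 and of g to the gradients f' (ys i), plus affine
   terms in y. Completing the square puts it in the exact form
   m + pnorm (y - v k)^2 / 2 + A k / (2 L) * dnorm (g - s k)^2,
   and evaluating this at (xstar, s k) expresses A k * W k (xstar, s k) through m. *)
theory Submission
  imports Defs
begin

section \<open>Bijectivity of \<open>B\<close> and the algebra of the primal and dual norms\<close>

lemma sym_pos_def_bij:
  fixes B :: "'a::euclidean_space \<Rightarrow> 'a \<Rightarrow>\<^sub>L real"
  assumes "sym_pos_def B"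
  shows "bij B"
proof -
  have lin: "linear B" and pos: "\<And>x. x \<noteq> 0 \<Longrightarrow> blinfun_apply (B x) x > 0"
    using assms by (auto simp: sym_pos_def_def)
  have ker: "x = 0" if "B x = 0" for x
    using pos[of x] that by auto
  (* The dual is not an instance of euclidean_space, so count dimensions on 'a through coordinates. *)
  define T :: "'a \<Rightarrow> 'a" where "T x = (\<Sum>b\<in>Basis. blinfun_apply (B x) b *\<^sub>R b)" for x
  have T: "T x \<bullet> b = blinfun_apply (B x) b" if "b \<in> Basis" for x b
    using that by (simp add: T_def)
  have "linear T"
    by (auto intro!: linearI euclidean_eqI[where 'a = 'a]
        simp: T inner_add_left linear_add[OF lin] linear_scale[OF lin]
          blinfun.add_left blinfun.scaleR_left)
  moreover have "x = 0" if "T x = 0" for x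
  proof (rule ker, rule blinfun_euclidean_eqI)
    show "blinfun_apply (B x) b = blinfun_apply 0 b" if "b \<in> Basis" for b
      using T[OF that, of x] \<open>T x = 0\<close> by simp
  qed
  ultimately have "surj T"
    by (simp add: linear_injective_imp_surjective linear_injective_0)
  have "\<exists>x. B x = g" for g
  proof -
    obtain x where "T x = (\<Sum>b\<in>Basis. blinfun_apply g b *\<^sub>R b)"
      using \<open>surj T\<close> by (metis surjD)
    then have "blinfun_apply (B x) b = blinfun_apply g b" if "b \<in> Basis" for b
      using T[OF that, of x] that by simp
    then show ?thesis
      by (blast intro: blinfun_euclidean_eqI)
  qed
  moreover have "inj B"
    using ker lin by (simp add: linear_injective_0)
  ultimately show ?thesis
    by (metis bij_def surjI surj_def)
qed

lemma sym_pos_def_nonneg: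
  assumes "sym_pos_def B"
  shows "blinfun_apply (B x) x \<ge> 0"
  using assms by (cases "x = 0") (auto simp: sym_pos_def_def less_imp_le)

lemma pnorm_power2:
  assumes "sym_pos_def B"
  shows "(pnorm B x)\<^sup>2 = blinfun_apply (B x) x"
  using sym_pos_def_nonneg[OF assms] by (simp add: pnorm_def)

lemma pnorm_minus_commute:
  assumes "sym_pos_def B"
  shows "pnorm B (x - y) = pnorm B (y - x)"
proof -
  have "linear B" using assms by (simp add: sym_pos_def_def)
  then show ?thesis
    by (simp add: pnorm_def linear_diff blinfun.diff_left blinfun.diff_right algebra_simps)
qed

text \<open>\<open>B\<close> is onto, so \<open>B (inv B g) = g\<close>. Hence \<open>inv B\<close>
  carries \<open>dnorm\<close> to \<open>pnorm\<close>, and the quadratic identities for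
  \<open>dnorm\<close> can be inherited from those for \<open>pnorm\<close>.\<close>

lemma dnorm_eq_pnorm:
  assumes "sym_pos_def B"
  shows "dnorm B g = pnorm B (inv B g)"
  using sym_pos_def_bij[OF assms] by (simp add: dnorm_def pnorm_def bij_is_surj surj_f_inv_f)

lemma pnorm_eq_0_iff:
  assumes "sym_pos_def B"
  shows "pnorm B x = 0 \<longleftrightarrow> x = 0"
proof -
  have "linear B" using assms by (simp add: sym_pos_def_def)
  then show ?thesis
    using assms unfolding sym_pos_def_def pnorm_def
    by (metis blinfun.zero_right less_irrefl real_sqrt_eq_zero_cancel_iff)
qed

lemma linear_inv_sym_pos_def:
  assumes "sym_pos_def B"
  shows "linear (inv B)"
proof (rule linearI)
  have lin: "linear B" and B: "\<And>g. B (inv B g) = g" "\<And>x. inv B (B x) = x"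
    using assms sym_pos_def_bij[OF assms]
    by (auto simp: sym_pos_def_def bij_is_surj surj_f_inv_f bij_is_inj)
  show "inv B (g + h) = inv B g + inv B h" for g h
    by (metis B linear_add[OF lin])
  show "inv B (c *\<^sub>R g) = c *\<^sub>R inv B g" for c g
    by (metis B linear_scale[OF lin])
qed

lemma dnorm_eq_0_iff:
  assumes "sym_pos_def B"
  shows "dnorm B g = 0 \<longleftrightarrow> g = 0"
  using sym_pos_def_bij[OF assms] linear_0[OF linear_inv_sym_pos_def[OF assms]]
  by (metis assms bij_is_surj dnorm_eq_pnorm pnorm_eq_0_iff surj_f_inv_f)

text \<open>By symmetry of \<open>B\<close> both cross terms equal \<open>c\<close> times the value
  of \<open>g\<close> at \<open>y\<close>. Read backwards, this absorbs a linear term in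
  \<open>y\<close> into a square by moving its centre along \<open>inv B g\<close>.\<close>

lemma pnorm_shift_power2:
  assumes "sym_pos_def B"
  shows "(pnorm B (y + c *\<^sub>R inv B g))\<^sup>2
    = (pnorm B y)\<^sup>2 + 2 * c * blinfun_apply g y + c\<^sup>2 * (dnorm B g)\<^sup>2"
proof -
  have lin: "linear B" and sym: "\<And>x y. blinfun_apply (B x) y = blinfun_apply (B y) x"
    using assms by (auto simp: sym_pos_def_def)
  have g: "B (inv B g) = g"
    using sym_pos_def_bij[OF assms] by (simp add: bij_is_surj surj_f_inv_f)
  have "blinfun_apply (B y) (inv B g) = blinfun_apply g y"
    using sym[of y "inv B g"] g by simp
  then show ?thesis
    by (simp add: pnorm_power2[OF assms] dnorm_eq_pnorm[OF assms] linear_add[OF lin]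
        linear_scale[OF lin] g blinfun.add_left blinfun.add_right blinfun.scaleR_left
        blinfun.scaleR_right) (simp add: algebra_simps power2_eq_square)
qed

text \<open>Expanding both sides and using symmetry of \<open>B\<close>, the cross terms agree. In
  its dual form this merges two weighted squared distances into one distance from the weighted mean,
  plus a constant.\<close>

lemma pnorm_convex_combination:
  assumes "sym_pos_def B"
  shows "(1 - t) * (pnorm B x)\<^sup>2 + t * (pnorm B y)\<^sup>2
    = (pnorm B ((1 - t) *\<^sub>R x + t *\<^sub>R y))\<^sup>2 + t * (1 - t) * (pnorm B (x - y))\<^sup>2"
proof -
  have lin: "linear B" and "blinfun_apply (B x) y = blinfun_apply (B y) x"
    using assms by (auto simp: sym_pos_def_def)
  then show ?thesis
    by (simp add: pnorm_power2[OF assms] linear_add[OF lin] linear_diff[OF lin]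
        linear_scale[OF lin] blinfun.add_left blinfun.add_right blinfun.diff_left
        blinfun.diff_right blinfun.scaleR_left blinfun.scaleR_right) (simp add: algebra_simps)
qed

lemma dnorm_convex_combination:
  assumes "sym_pos_def B"
  shows "(1 - t) * (dnorm B g)\<^sup>2 + t * (dnorm B h)\<^sup>2
    = (dnorm B ((1 - t) *\<^sub>R g + t *\<^sub>R h))\<^sup>2 + t * (1 - t) * (dnorm B (g - h))\<^sup>2"
  using pnorm_convex_combination[OF assms, of t "inv B g" "inv B h"]
    linear_inv_sym_pos_def[OF assms]
  by (simp add: dnorm_eq_pnorm[OF assms] linear_add linear_diff linear_scale)

section \<open>Accumulated weights and completion of the square\<close>

lemma Acc_nonneg:
  assumes "\<And>i. a (Suc i) > 0"
  shows "Acc a k \<ge> 0"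
  by (induction k) (use assms in \<open>auto simp: less_imp_le\<close>)

lemma Acc_pos:
  assumes "\<And>i. a (Suc i) > 0" and "k \<ge> 1"
  shows "Acc a k > 0"
  using assms(2) Acc_nonneg[of a "k - 1", OF assms(1)] assms(1)[of "k - 1"] by (cases k) auto

lemma psi_eq_sum:
  "psi B f f' L x0 ys a k y g
    = (\<Sum>i=1..k. a i * w B f f' L ys i y g) + 1 / 2 * (pnorm B (y - x0))\<^sup>2"
  by (induction k) auto

text \<open>Each induction step adds an affine function of \<open>y\<close>, which only shifts
  \<open>p\<close> and \<open>m\<close>, and a squared distance in \<open>g\<close>, which averages
  into \<open>q\<close> and changes \<open>m\<close>.\<close>

lemma psi_complete_square:
  fixes B :: "'a::euclidean_space \<Rightarrow> 'a \<Rightarrow>\<^sub>L real"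
  assumes B: "sym_pos_def B" and a: "\<And>i. a (Suc i) > 0"
  shows "\<exists>p q m. \<forall>y g. psi B f f' L x0 ys a k y g
    = m + 1 / 2 * (pnorm B (y - p))\<^sup>2 + Acc a k / (2 * L) * (dnorm B (g - q))\<^sup>2"
proof (induction k)
  case 0
  \<comment> \<open>\<open>Acc a 0 = 0\<close> removes the dual square, so the choice
    \<open>q = 0\<close> is arbitrary.\<close>
  show ?case by (rule exI[of _ x0], rule exI[of _ 0], rule exI[of _ 0]) simp
next
  case (Suc k)
  then obtain p q m where IH: "\<And>y g. psi B f f' L x0 ys a k y g
    = m + 1 / 2 * (pnorm B (y - p))\<^sup>2 + Acc a k / (2 * L) * (dnorm B (g - q))\<^sup>2"
    by blast
  define z c \<alpha> A where "z = ys (Suc k)" and "c = f' z" and "\<alpha> = a (Suc k)" and "A = Acc a k"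
  \<comment> \<open>\<open>t\<close> is the share of the new weight in the total, so
    \<open>q'\<close> is the mean of \<open>q\<close> and \<open>c\<close> with weights
    \<open>A\<close> and \<alpha>. For \<open>k = 0\<close> it is 1 and the old centre drops
    out.\<close>
  define t where "t = \<alpha> / (A + \<alpha>)"
  define p' where "p' = p - \<alpha> *\<^sub>R inv B c"
  define q' where "q' = (1 - t) *\<^sub>R q + t *\<^sub>R c"
  \<comment> \<open>The affine part is now evaluated at \<open>p\<close>. The term with \<alpha>
    squared compensates for completing the square in \<open>y\<close>, and the last term is the
    spread between \<open>q\<close> and \<open>c\<close> left over from merging the dual
    squares.\<close>
  define m' where "m' = m + \<alpha> * (f z + blinfun_apply c (p - z)) - 1 / 2 * \<alpha>\<^sup>2 * (dnorm B c)\<^sup>2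
    + (A + \<alpha>) / (2 * L) * (t * (1 - t) * (dnorm B (q - c))\<^sup>2)"
  have "A + \<alpha> > 0"
    using a[of k] Acc_nonneg[of a k, OF a] by (simp add: A_def \<alpha>_def)
  then have t: "\<alpha> = (A + \<alpha>) * t" "A = (A + \<alpha>) * (1 - t)"
    by (auto simp: t_def field_simps)
  have "psi B f f' L x0 ys a (Suc k) y g
    = m' + 1 / 2 * (pnorm B (y - p'))\<^sup>2 + (A + \<alpha>) / (2 * L) * (dnorm B (g - q'))\<^sup>2" for y g
  proof -
    have "(pnorm B (y - p'))\<^sup>2
      = (pnorm B (y - p))\<^sup>2 + 2 * \<alpha> * blinfun_apply c (y - p) + \<alpha>\<^sup>2 * (dnorm B c)\<^sup>2"
      using pnorm_shift_power2[OF B, of "y - p" \<alpha> c] by (simp add: p'_def algebra_simps)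
    moreover have "A / (2 * L) * (dnorm B (g - q))\<^sup>2 + \<alpha> / (2 * L) * (dnorm B (g - c))\<^sup>2
      = (A + \<alpha>) / (2 * L) * ((dnorm B (g - q'))\<^sup>2 + t * (1 - t) * (dnorm B (q - c))\<^sup>2)"
    proof -
      have "(1 - t) *\<^sub>R (g - q) + t *\<^sub>R (g - c) = g - q'"
        by (simp add: q'_def algebra_simps)
      \<comment> \<open>The difference simplifies to \<open>c - q\<close>, so \<open>g\<close>
        cancels and the spread is indeed a constant; only the sign has to be flipped.\<close>
      moreover have "dnorm B (g - q - (g - c)) = dnorm B (q - c)"
        using linear_inv_sym_pos_def[OF B]
        by (simp add: dnorm_eq_pnorm[OF B] linear_diff pnorm_minus_commute[OF B])
      ultimately have comb: "(1 - t) * (dnorm B (g - q))\<^sup>2 + t * (dnorm B (g - c))\<^sup>2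
          = (dnorm B (g - q'))\<^sup>2 + t * (1 - t) * (dnorm B (q - c))\<^sup>2"
        using dnorm_convex_combination[OF B, of t "g - q" "g - c"] by simp
      have "(A + \<alpha>) / (2 * L) * ((dnorm B (g - q'))\<^sup>2 + t * (1 - t) * (dnorm B (q - c))\<^sup>2)
        = ((A + \<alpha>) * (1 - t)) / (2 * L) * (dnorm B (g - q))\<^sup>2
          + ((A + \<alpha>) * t) / (2 * L) * (dnorm B (g - c))\<^sup>2"
        unfolding comb[symmetric] by (simp add: distrib_left mult.assoc)
      then show ?thesis
        by (simp only: t[symmetric])
    qed
    ultimately show ?thesis
      unfolding psi.simps IH w_def m'_def
      unfolding z_def[symmetric] c_def[symmetric] \<alpha>_def[symmetric] A_def[symmetric]
      by (simp add: algebra_simps blinfun.diff_right)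
  qed
  then show ?case
    by (auto simp: A_def \<alpha>_def)
qed

section \<open>The minimizers, and the minimum of the augmented functions\<close>

lemma arg_min_unique:
  fixes F :: "'b \<Rightarrow> real"
  assumes "\<And>z. z \<noteq> z0 \<Longrightarrow> F z0 < F z"
  shows "arg_min F (\<lambda>_. True) = z0"
  unfolding arg_min_def is_arg_min_def
proof (rule some_equality)
  show "True \<and> \<not> (\<exists>y. True \<and> F y < F z0)"
    using assms by (metis less_asym less_irrefl)
  show "z = z0" if "True \<and> \<not> (\<exists>y. True \<and> F y < F z)" for z
    using assms that by blast
qed

text \<open>Identifies the centres of the completed square with \<open>v\<close> and
  \<open>s\<close>. As \<open>arg_min\<close> is defined by choice, this needs \<open>(p, q)\<close>
  to be the strict minimizer, which follows from positive coefficients on both squares and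
  definiteness of both norms.\<close>

lemma psi_minimizer_form:
  fixes B :: "'a::euclidean_space \<Rightarrow> 'a \<Rightarrow>\<^sub>L real"
  assumes B: "sym_pos_def B" and L: "L > 0" and a: "\<And>i. a (Suc i) > 0" and k: "k \<ge> 1"
  obtains m where "\<And>y g. psi B f f' L x0 ys a k y g
    = m + 1 / 2 * (pnorm B (y - v B f f' L x0 ys a k))\<^sup>2
      + Acc a k / (2 * L) * (dnorm B (g - s B f f' L x0 ys a k))\<^sup>2"
proof -
  obtain p q m where psi: "\<And>y g. psi B f f' L x0 ys a k y g
    = m + 1 / 2 * (pnorm B (y - p))\<^sup>2 + Acc a k / (2 * L) * (dnorm B (g - q))\<^sup>2"
    using psi_complete_square[of B a f f' L x0 ys k, OF B a] by blast
  \<comment> \<open>Here \<open>k\<close> must be at least 1: for \<open>k = 0\<close> the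
    coefficient vanishes and \<open>g\<close> is undetermined.\<close>
  have A: "Acc a k / (2 * L) > 0"
    using Acc_pos[of a k, OF a k] L by simp
  have "m < psi B f f' L x0 ys a k y g" if "y \<noteq> p \<or> g \<noteq> q" for y g
  proof -
    have "pnorm B (y - p) \<noteq> 0 \<or> dnorm B (g - q) \<noteq> 0"
      using that by (simp add: pnorm_eq_0_iff[OF B] dnorm_eq_0_iff[OF B])
    then have "1 / 2 * (pnorm B (y - p))\<^sup>2 + Acc a k / (2 * L) * (dnorm B (g - q))\<^sup>2 > 0"
    proof
      assume "pnorm B (y - p) \<noteq> 0"
      then show ?thesis
        using A by (intro add_pos_nonneg mult_nonneg_nonneg) auto
    next
      assume "dnorm B (g - q) \<noteq> 0"
      then show ?thesis
        using A by (intro add_nonneg_pos mult_pos_pos) auto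
    qed
    then show ?thesis by (simp add: psi)
  qed
  moreover have "psi B f f' L x0 ys a k p q = m"
    using pnorm_eq_0_iff[OF B, of 0] dnorm_eq_0_iff[OF B, of 0] by (simp add: psi)
  ultimately have "arg_min (\<lambda>(y, g). psi B f f' L x0 ys a k y g) (\<lambda>_. True) = (p, q)"
    by (intro arg_min_unique) auto
  then have "v B f f' L x0 ys a k = p" "s B f f' L x0 ys a k = q"
    using k by (simp_all add: v_def s_def psi_minimizer_def)
  with psi that show thesis by blast
qed

text \<open>The augmentation is constant in \<open>(y, g)\<close>, so the minimum is still attained
  at the pair of \<open>v\<close> and \<open>s\<close>. Its value is \<open>m\<close> plus that
  constant, and \<open>m\<close> cancels against the one inside \<open>W\<close>.\<close>

lemma psi_bar_min_eq:
  fixes B :: "'a::euclidean_space \<Rightarrow> 'a \<Rightarrow>\<^sub>L real"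
  assumes B: "sym_pos_def B" and L: "L > 0" and a: "\<And>i. a (Suc i) > 0" and k: "k \<ge> 1"
  shows "psi_bar_min B f f' L x0 ys a xstar k
    = Acc a k * f xstar + 1 / 2 * (pnorm B (xstar - x0))\<^sup>2
      - 1 / 2 * (pnorm B (xstar - v B f f' L x0 ys a k))\<^sup>2"
proof -
  let ?v = "v B f f' L x0 ys a k" and ?s = "s B f f' L x0 ys a k" and ?A = "Acc a k"
  let ?W = "W B f f' L ys a k xstar ?s"
  obtain m where psi: "\<And>y g. psi B f f' L x0 ys a k y g
    = m + 1 / 2 * (pnorm B (y - ?v))\<^sup>2 + ?A / (2 * L) * (dnorm B (g - ?s))\<^sup>2"
    using psi_minimizer_form[of B L a k f f' x0 ys, OF B L a k] by blast
  have A: "?A > 0" using Acc_pos[of a k, OF a k] .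
  have zero: "pnorm B 0 = 0" "dnorm B 0 = 0"
    using pnorm_eq_0_iff[OF B] dnorm_eq_0_iff[OF B] by auto
  \<comment> \<open>Taking \<open>?s\<close> as dual argument makes the dual square vanish;
    \<open>?A > 0\<close> cancels the normalization in \<open>W\<close>.\<close>
  have "?A * ?W + 1 / 2 * (pnorm B (xstar - x0))\<^sup>2 = psi B f f' L x0 ys a k xstar ?s"
    using A by (simp add: psi_eq_sum W_def)
  also have "\<dots> = m + 1 / 2 * (pnorm B (xstar - ?v))\<^sup>2"
    by (simp add: psi zero)
  finally have W: "?A * ?W = m + 1 / 2 * (pnorm B (xstar - ?v))\<^sup>2
      - 1 / 2 * (pnorm B (xstar - x0))\<^sup>2"
    by simp
  have "psi_bar_min B f f' L x0 ys a xstar k = m + ?A * (f xstar - ?W)"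
    unfolding psi_bar_min_def
  proof (rule Least_equality)
    show "\<exists>y g. m + ?A * (f xstar - ?W) = psi_bar B f f' L x0 ys a xstar k y g"
      by (rule exI[of _ ?v], rule exI[of _ ?s]) (simp add: psi_bar_def psi zero)
  \<comment> \<open>Minimality: every value exceeds the claimed one by two nonnegative square
    terms.\<close>
  qed (use A L in \<open>auto simp: psi_bar_def psi\<close>)
  then show ?thesis
    using W by (simp add: right_diff_distrib)
qed

theorem proposition5p1:
  fixes B :: "'a::euclidean_space \<Rightarrow> 'a \<Rightarrow>\<^sub>L real"
    and f :: "'a \<Rightarrow> real"
    and f' :: "'a \<Rightarrow> 'a \<Rightarrow>\<^sub>L real"
    and L :: real
    and x0 xstar :: 'a
    and ys :: "nat \<Rightarrow> 'a"
    and a :: "nat \<Rightarrow> real"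
    and k :: nat
  assumes "sym_pos_def B"
    and "convex_on UNIV f"
    and "\<And>x. (f has_derivative blinfun_apply (f' x)) (at x)"
    and "L > 0"
    and "\<And>x y. dnorm B (f' x - f' y) \<le> L * pnorm B (x - y)"
    and "\<And>x. f xstar \<le> f x"
    and "ys 0 = x0"
    and "\<And>i. a (Suc i) > 0"
    and "k \<ge> 1"
  shows "Gamma_bar B f f' L x0 ys a xstar k
    = gap B f f' L x0 ys a xstar 0 - gap B f f' L x0 ys a xstar k"
proof -
  \<comment> \<open>With \<open>Acc a 0 = 0\<close>, this convention reduces the initial gap to half
    the squared distance from \<open>x0\<close> to \<open>xstar\<close>. The terms in
    \<open>f (ys k)\<close> and its gradient occur identically in \<open>Gamma_bar\<close> and in
    minus the \<open>k\<close>-th gap.\<close>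
  have "v B f f' L x0 ys a 0 = x0"
    by (simp add: v_def psi_minimizer_def)
  then show ?thesis
    using psi_bar_min_eq[of B L a k f f' x0 ys xstar, OF assms(1,4,8,9)]
    by (simp add: Gamma_bar_def gap_def pnorm_minus_commute[OF assms(1), of xstar] algebra_simps)
qed

end
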